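(* Let $G$ be a group acting on a finite set $X$, and let $f,g\in \mathrm{End}_G(X)$. Then $f\sim_{\mathcal{L}} g$ if and only if $\ker(f)=\ker(g)$.
   Context: $\mathrm{End}_G(X)$ is the monoid, under composition $(fg)(x)=f(g(x))$, of all $G$-equivariant functions $\tau:X\to X$, i.e. $\tau(g\cdot x)=g\cdot\tau(x)$ for all $g\in G$, $x\in X$. Write $S=\mathrm{End}_G(X)$. For $a,b\in S$, $a\sim_{\mathcal{L}} b$ means $Sa=Sb$, where $Sa=\{sa : s\in S\}$. The kernel of $f$ is $\ker(f)=\{(x,y)\in X\times X : f(x)=f(y)\}$. *)

theory Defs
  imports "HOL-Algebra.Group_Action"
begin

text \<open>Self-maps of \<open>X\<close> are represented by \<^term>\<open>X \<rightarrow>\<^sub>E X\<close>, so that equality in the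
  monoid is equality of maps on \<open>X\<close>; this is also the convention of \<^const>\<open>BijGroup\<close>, on which
  \<^locale>\<open>group_action\<close> is built.\<close>

definition equivariant_End ::
    "('g, 'm) monoid_scheme \<Rightarrow> 'x set \<Rightarrow> ('g \<Rightarrow> 'x \<Rightarrow> 'x) \<Rightarrow> ('x \<Rightarrow> 'x) monoid"
  where
  "equivariant_End G X \<phi> =
    \<lparr>carrier = {\<tau> \<in> X \<rightarrow>\<^sub>E X. \<forall>h \<in> carrier G. \<forall>x \<in> X. \<tau> (\<phi> h x) = \<phi> h (\<tau> x)},
     mult = compose X,
     one = (\<lambda>x\<in>X. x)\<rparr>"

text \<open>\<open>carrier S #>\<^bsub>S\<^esub> a\<close> is the principal left ideal \<open>Sa = {sa | s \<in> S}\<close>.\<close>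

definition green_L :: "('s, 'm) monoid_scheme \<Rightarrow> 's \<Rightarrow> 's \<Rightarrow> bool"
  where "green_L S a b \<longleftrightarrow> carrier S #>\<^bsub>S\<^esub> a = carrier S #>\<^bsub>S\<^esub> b"

definition ker_on :: "'x set \<Rightarrow> ('x \<Rightarrow> 'y) \<Rightarrow> ('x \<times> 'x) set"
  where "ker_on X f = {(x, y) \<in> X \<times> X. f x = f y}"

lemma monoid_equivariant_End:
  assumes "group_action G X \<phi>"
  shows "monoid (equivariant_End G X \<phi>)"
proof -
  have act: "\<phi> h x \<in> X" if "h \<in> carrier G" "x \<in> X" for h x
    using group_action.element_image[OF assms that refl] .
  show ?thesis
    by (rule monoidI)
       (auto simp: equivariant_End_def compose_def PiE_iff act
         extensional_def intro!: ext)
qed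

end

theory Submission
  imports Defs
begin

text \<open>If \<open>ker f \<subseteq> ker g\<close>, then \<open>f x \<mapsto> g x\<close> is a well-defined equivariant map on the image of
  \<open>f\<close>. The complement of that image is \<open>G\<close>-invariant, so extending by the identity there gives
  \<open>s \<in> End\<^sub>G(X)\<close> with \<open>s f = g\<close>.\<close>

lemma mem_left_ideal_imp_ker_on_subset:
  assumes "g \<in> carrier (equivariant_End G X \<phi>) #>\<^bsub>equivariant_End G X \<phi>\<^esub> f"
  shows "ker_on X f \<subseteq> ker_on X g"
proof -
  obtain s where "g = compose X s f"
    using assms by (auto simp: equivariant_End_def r_coset_def)
  then show ?thesis
    by (auto simp: ker_on_def compose_eq)
qed

text \<open>Kernel inclusion in one direction yields a left factor; applying this to both ordered
  pairs gives the equivalence for equal kernels.\<close>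

lemma ker_on_subset_imp_mem_left_ideal:
  assumes "group_action G X \<phi>"
    and f: "f \<in> carrier (equivariant_End G X \<phi>)"
    and g: "g \<in> carrier (equivariant_End G X \<phi>)"
    and ker: "ker_on X f \<subseteq> ker_on X g"
  shows "g \<in> carrier (equivariant_End G X \<phi>) #>\<^bsub>equivariant_End G X \<phi>\<^esub> f"
proof -
  interpret group_action G X \<phi> by fact
  interpret G: group G using group_hom group_hom.axioms(1) by blast
  have act: "\<phi> h x \<in> X" if "h \<in> carrier G" "x \<in> X" for h x
    using element_image[OF that refl] .
  have fX: "f x \<in> X" and gX: "g x \<in> X" if "x \<in> X" for x
    using f g that by (auto simp: equivariant_End_def)
  have feq: "f (\<phi> h x) = \<phi> h (f x)" and geq: "g (\<phi> h x) = \<phi> h (g x)"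
    if "h \<in> carrier G" "x \<in> X" for h x
    using f g that by (auto simp: equivariant_End_def)
  \<comment> \<open>\<open>inv_into\<close> picks an arbitrary preimage under \<open>f\<close>. The
    restriction to \<open>X\<close> makes \<open>s\<close> extensional, as membership in the monoid
    demands.\<close>
  define s where "s = (\<lambda>y\<in>X. if y \<in> f ` X then g (inv_into X f y) else y)"
  have sf: "s (f x) = g x" if "x \<in> X" for x
  proof -
    have "inv_into X f (f x) \<in> X" "f (inv_into X f (f x)) = f x"
      using that by (auto intro: inv_into_into f_inv_into_f)
    \<comment> \<open>The chosen preimage and \<open>x\<close> form a pair in the kernel of
      \<open>f\<close>, hence in that of \<open>g\<close>, so the choice does not affect the
      value.\<close>
    then have "g (inv_into X f (f x)) = g x"
      using ker that by (auto simp: ker_on_def)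
    then show ?thesis using that fX by (simp add: s_def)
  qed
  have s_id: "s y = y" if "y \<in> X" "y \<notin> f ` X" for y
    using that by (simp add: s_def)
  have s_closed: "s y \<in> X" if "y \<in> X" for y
    using that sf gX s_id by (cases "y \<in> f ` X") auto
  have s_eq: "s (\<phi> h y) = \<phi> h (s y)" if h: "h \<in> carrier G" and y: "y \<in> X" for h y
  proof (cases "y \<in> f ` X")
    case True
    then obtain x where x: "x \<in> X" "y = f x" by blast
    have "s (\<phi> h (f x)) = s (f (\<phi> h x))" using feq h x by simp
    also have "\<dots> = \<phi> h (s (f x))" using sf geq act h x by simp
    finally show ?thesis using x by simp
  next
    case False
    \<comment> \<open>If \<open>h\<close> moved \<open>y\<close> into the image, acting by the
      inverse of \<open>h\<close> would bring \<open>y\<close> back into it, since the image of an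
      equivariant map is closed under the action.\<close>
    have "\<phi> h y \<notin> f ` X"
    proof
      assume "\<phi> h y \<in> f ` X"
      then obtain x where x: "x \<in> X" "\<phi> h y = f x" by blast
      have "y = \<phi> (inv\<^bsub>G\<^esub> h) (f x)" using orbit_sym_aux[OF h y x(2)] by simp
      also have "\<dots> = f (\<phi> (inv\<^bsub>G\<^esub> h) x)" using feq h x by simp
      finally show False using False act h x by blast
    qed
    then show ?thesis using False s_id act h y by simp
  qed
  have "s \<in> carrier (equivariant_End G X \<phi>)"
    using s_closed s_eq by (auto simp: equivariant_End_def s_def)
  moreover have "compose X s f = g"
  proof (rule extensionalityI)
    show "g \<in> extensional X"
      using g by (simp add: equivariant_End_def PiE_iff)
  qed (simp_all add: compose_eq sf)
  ultimately show ?thesis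
    unfolding r_coset_def by (intro UN_I) (auto simp: equivariant_End_def)
qed

text \<open>The unit puts \<open>a\<close> into its own left ideal; conversely, if
  \<open>a = s \<otimes> b\<close>, associativity turns every left multiple of \<open>a\<close> into
  one of \<open>b\<close>. This reduces equality of left ideals to two memberships.\<close>

lemma (in monoid) left_ideal_subset_iff:
  assumes "a \<in> carrier G" and "b \<in> carrier G"
  shows "carrier G #> a \<subseteq> carrier G #> b \<longleftrightarrow> a \<in> carrier G #> b"
proof
  have "a \<in> carrier G #> a"
    unfolding r_coset_def using assms by (intro UN_I[OF one_closed]) simp
  then show "a \<in> carrier G #> b" if "carrier G #> a \<subseteq> carrier G #> b"
    using that by blast
next
  assume "a \<in> carrier G #> b"
  then obtain s where "s \<in> carrier G" "a = s \<otimes> b"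
    by (auto simp: r_coset_def)
  then show "carrier G #> a \<subseteq> carrier G #> b"
    using assms by (auto simp: r_coset_def simp flip: m_assoc)
qed

theorem theorem8:
  fixes G :: "('g, 'm) monoid_scheme"
    and X :: "'x set"
    and \<phi> :: "'g \<Rightarrow> 'x \<Rightarrow> 'x"
    and f g :: "'x \<Rightarrow> 'x"
  assumes "group_action G X \<phi>"
    and "finite X"
    and "f \<in> carrier (equivariant_End G X \<phi>)"
    and "g \<in> carrier (equivariant_End G X \<phi>)"
  shows "green_L (equivariant_End G X \<phi>) f g \<longleftrightarrow> ker_on X f = ker_on X g"
proof -
  interpret S: monoid "equivariant_End G X \<phi>"
    by (rule monoid_equivariant_End) fact
  have iff: "a \<in> carrier (equivariant_End G X \<phi>) #>\<^bsub>equivariant_End G X \<phi>\<^esub> b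
      \<longleftrightarrow> ker_on X b \<subseteq> ker_on X a"
    if "a \<in> carrier (equivariant_End G X \<phi>)" "b \<in> carrier (equivariant_End G X \<phi>)" for a b
    using mem_left_ideal_imp_ker_on_subset
      ker_on_subset_imp_mem_left_ideal[OF assms(1) that(2,1)] by (rule iffI)
  show ?thesis
    unfolding green_L_def set_eq_subset
      S.left_ideal_subset_iff[OF assms(3,4)] S.left_ideal_subset_iff[OF assms(4,3)]
      iff[OF assms(3,4)] iff[OF assms(4,3)]
    \<comment> \<open>Passing from ideals to kernels reverses inclusions, so the two conjuncts
      appear in swapped order.\<close>
    by (rule conj_commute)
qed

end
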